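(* Let $(\mathbf{B},Y)$ be an $(\mathcal{F},\star)$-axial algebra with non-zero annihilator $\mathrm{Ann}(\mathbf{B})$. Then there exist another $(\mathcal{F},\star)$-axial algebra $(\mathbf{A},X)$ and a cocycle $\theta\in Z(\mathbf{A},\mathrm{Ann}(\mathbf{B});X)$ such that $\mathbf{B}=\mathbf{A}_\theta$. Also, if $Y$ is a minimal generating set of axes for $\mathbf{B}$, then $X$ is a minimal generating set of axes for $\mathbf{A}$.
   Context: Algebras over the field $F$ are not necessarily associative, and algebras and vector spaces may have arbitrary dimension. A fusion law over $F$ is a pair $(\mathcal{F},\star)$ with $\mathcal{F}\subseteq F$ and $\star\colon\mathcal{F}\times\mathcal{F}\to 2^{\mathcal{F}}$ symmetric. For a commutative algebra $\mathbf{A}$ and $x\in\mathbf{A}$: $L_x\colon y\mapsto xy$; $\mathrm{Spec}(x)$ is the set of eigenvalues of $L_x$; $\mathbf{A}^x_\lambda$ is the $\lambda$-eigenspace of $L_x$ ($0$ if $\lambda\notin\mathrm{Spec}(x)$); $\mathbf{A}^x_S=\bigoplus_{\lambda\in S}\mathbf{A}^x_\lambda$, with $\mathbf{A}^x_\emptyset=0$. The element $x$ is semisimple if every element of $\mathbf{A}$ lies in a finite-dimensional $L_x$-stable subspace and $L_x$ restricts to a diagonalisable map on every finite-dimensional $L_x$-stable subspace. An $(\mathcal{F},\star)$-axis is a nonzero semisimple idempotent $a$ with $\mathrm{Spec}(a)\subseteq\mathcal{F}$ and $\mathbf{A}^a_\lambda\mathbf{A}^a_\mu\subseteq\mathbf{A}^a_{\lambda\star\mu}$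 for all $\lambda,\mu\in\mathrm{Spec}(a)$. An $(\mathcal{F},\star)$-axial algebra is a pair $(\mathbf{A},X)$ with $\mathbf{A}$ a commutative algebra and $X$ a finite set of $(\mathcal{F},\star)$-axes generating $\mathbf{A}$ as an algebra. Minimal generating sets are minimal with respect to inclusion. $\mathrm{Ann}(\mathbf{B})=\{v\in\mathbf{B}\mid v\mathbf{B}=0\}$. For a vector space $V$ and a bilinear map $\theta\colon\mathbf{A}\times\mathbf{A}\to V$, the central extension $\mathbf{A}_\theta$ is the vector space $\mathbf{A}\dotplus V$ with product $[x+v,y+w]_\theta=xy+\theta(x,y)$, and $\theta_x^\perp=\{y\in\mathbf{A}\mid\theta(x,y)=0\}$. The equality $\mathbf{B}=\mathbf{A}_\theta$ is the identification of $\mathbf{B}$, as an algebra, with this central extension of $\mathbf{A}$ by $\mathrm{Ann}(\mathbf{B})$. For $X'\subseteq X$, the space of cocycles $Z(\mathbf{A},V;X')$ consists of the symmetric bilinear maps $\theta\colon\mathbf{A}\times\mathbf{A}\to V$ such that for every $a\in X'$: (1) $\ker L_a\subseteq\theta_a^\perp$; and (2) for all $\lambda,\mu\in\mathrm{Spec}(a)$ with $0\notin\lambda\star\mu$ and all $x\in\mathbf{A}^a_\lambda$, $y\in\mathbf{A}^a_\mu$, one has $\theta(x,y)=\sum_{\nu\in\lambda\star\mu}\nu^{-1}\theta(a,z_\nu)$, where $xy=\sum_{\nu\in\lambda\star\mu}z_\nu$ with $z_\nu\in\mathbf{A}^a_\nu$. *)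

theory Defs
  imports "HOL-Analysis.Product_Vector"
begin

text \<open>
  An algebra is a subspace of an ambient vector space (a type with an explicit scalar
  multiplication over the field \<open>'f\<close>), together with a product. Addition is that of the type;
  the product matters only on the carrier. The carrier may be the whole type, so that no vector
  space is excluded.
\<close>

record ('f, 'a) alg =
  alg_carrier :: "'a set"
  alg_scale :: "'f \<Rightarrow> 'a \<Rightarrow> 'a"
  alg_mult :: "'a \<Rightarrow> 'a \<Rightarrow> 'a"

definition linear_map_on ::
  "('f::field \<Rightarrow> 'a::ab_group_add \<Rightarrow> 'a) \<Rightarrow> ('f \<Rightarrow> 'b::ab_group_add \<Rightarrow> 'b) \<Rightarrow> 'a set \<Rightarrow> ('a \<Rightarrow> 'b) \<Rightarrow> bool"
where
  "linear_map_on s t U f \<longleftrightarrow>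
     (\<forall>x\<in>U. \<forall>y\<in>U. f (x + y) = f x + f y) \<and> (\<forall>c. \<forall>x\<in>U. f (s c x) = t c (f x))"

definition bilinear_map_on ::
  "('f::field \<Rightarrow> 'a::ab_group_add \<Rightarrow> 'a) \<Rightarrow> ('f \<Rightarrow> 'b::ab_group_add \<Rightarrow> 'b) \<Rightarrow> 'a set
     \<Rightarrow> ('a \<Rightarrow> 'a \<Rightarrow> 'b) \<Rightarrow> bool"
where
  "bilinear_map_on s t U f \<longleftrightarrow>
     (\<forall>x\<in>U. linear_map_on s t U (f x)) \<and> (\<forall>y\<in>U. linear_map_on s t U (\<lambda>x. f x y))"

definition comm_algebra :: "('f::field, 'a::ab_group_add) alg \<Rightarrow> bool" where
  "comm_algebra A \<longleftrightarrow>
     vector_space (alg_scale A) \<and>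
     module.subspace (alg_scale A) (alg_carrier A) \<and>
     (\<forall>x\<in>alg_carrier A. \<forall>y\<in>alg_carrier A. alg_mult A x y \<in> alg_carrier A) \<and>
     bilinear_map_on (alg_scale A) (alg_scale A) (alg_carrier A) (alg_mult A) \<and>
     (\<forall>x\<in>alg_carrier A. \<forall>y\<in>alg_carrier A. alg_mult A x y = alg_mult A y x)"

definition annihilator :: "('f::field, 'a::ab_group_add) alg \<Rightarrow> 'a set" where
  "annihilator A = {v \<in> alg_carrier A. \<forall>w\<in>alg_carrier A. alg_mult A v w = 0}"

definition alg_iso ::
  "('f::field, 'a::ab_group_add) alg \<Rightarrow> ('f, 'b::ab_group_add) alg \<Rightarrow> ('a \<Rightarrow> 'b) \<Rightarrow> bool"
where
  "alg_iso A B \<phi> \<longleftrightarrow>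
     bij_betw \<phi> (alg_carrier A) (alg_carrier B) \<and>
     linear_map_on (alg_scale A) (alg_scale B) (alg_carrier A) \<phi> \<and>
     (\<forall>x\<in>alg_carrier A. \<forall>y\<in>alg_carrier A. \<phi> (alg_mult A x y) = alg_mult B (\<phi> x) (\<phi> y))"

definition is_subalgebra :: "('f::field, 'a::ab_group_add) alg \<Rightarrow> 'a set \<Rightarrow> bool" where
  "is_subalgebra A S \<longleftrightarrow>
     S \<subseteq> alg_carrier A \<and> module.subspace (alg_scale A) S \<and>
     (\<forall>x\<in>S. \<forall>y\<in>S. alg_mult A x y \<in> S)"

definition generates :: "('f::field, 'a::ab_group_add) alg \<Rightarrow> 'a set \<Rightarrow> bool" where
  "generates A X \<longleftrightarrow> X \<subseteq> alg_carrier A \<and> is_subalgebra A hull X = alg_carrier A"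

definition eigenspace :: "('f::field, 'a::ab_group_add) alg \<Rightarrow> 'a \<Rightarrow> 'f \<Rightarrow> 'a set" where
  "eigenspace A x \<kappa> = {y \<in> alg_carrier A. alg_mult A x y = alg_scale A \<kappa> y}"

definition Spec :: "('f::field, 'a::ab_group_add) alg \<Rightarrow> 'a \<Rightarrow> 'f set" where
  "Spec A x = {\<kappa>. \<exists>y\<in>alg_carrier A. y \<noteq> 0 \<and> alg_mult A x y = alg_scale A \<kappa> y}"

text \<open>
  The sum of the eigenspaces with eigenvalues in \<open>S\<close>; it is automatically direct, since
  eigenvectors for distinct eigenvalues are linearly independent.
\<close>

definition eigenspaces :: "('f::field, 'a::ab_group_add) alg \<Rightarrow> 'a \<Rightarrow> 'f set \<Rightarrow> 'a set" where
  "eigenspaces A x S = module.span (alg_scale A) (\<Union>\<kappa>\<in>S. eigenspace A x \<kappa>)"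

text \<open>Here \<open>W\<close> is a finite-dimensional subspace of the algebra that is stable under \<open>L\<^sub>x\<close>.\<close>

definition fin_dim_stable :: "('f::field, 'a::ab_group_add) alg \<Rightarrow> 'a \<Rightarrow> 'a set \<Rightarrow> bool" where
  "fin_dim_stable A x W \<longleftrightarrow>
     W \<subseteq> alg_carrier A \<and> (\<exists>S. finite S \<and> W = module.span (alg_scale A) S) \<and>
     (\<forall>y\<in>W. alg_mult A x y \<in> W)"

definition diagonalisable_on ::
  "('f::field \<Rightarrow> 'a::ab_group_add \<Rightarrow> 'a) \<Rightarrow> 'a set \<Rightarrow> ('a \<Rightarrow> 'a) \<Rightarrow> bool"
where
  "diagonalisable_on s W f \<longleftrightarrow>
     (\<exists>E. \<not> module.dependent s E \<and> module.span s E = W \<and> (\<forall>e\<in>E. \<exists>c. f e = s c e))"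

definition semisimple :: "('f::field, 'a::ab_group_add) alg \<Rightarrow> 'a \<Rightarrow> bool" where
  "semisimple A x \<longleftrightarrow>
     (\<forall>y\<in>alg_carrier A. \<exists>W. fin_dim_stable A x W \<and> y \<in> W) \<and>
     (\<forall>W. fin_dim_stable A x W \<longrightarrow> diagonalisable_on (alg_scale A) W (alg_mult A x))"

definition fusion_law :: "'f set \<Rightarrow> ('f \<Rightarrow> 'f \<Rightarrow> 'f set) \<Rightarrow> bool" where
  "fusion_law F star \<longleftrightarrow>
     (\<forall>\<kappa>\<in>F. \<forall>\<mu>\<in>F. star \<kappa> \<mu> \<subseteq> F \<and> star \<kappa> \<mu> = star \<mu> \<kappa>)"

definition axis ::
  "'f::field set \<Rightarrow> ('f \<Rightarrow> 'f \<Rightarrow> 'f set) \<Rightarrow> ('f, 'a::ab_group_add) alg \<Rightarrow> 'a \<Rightarrow> bool"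
where
  "axis F star A a \<longleftrightarrow>
     a \<in> alg_carrier A \<and> a \<noteq> 0 \<and> alg_mult A a a = a \<and> semisimple A a \<and> Spec A a \<subseteq> F \<and>
     (\<forall>\<kappa>\<in>Spec A a. \<forall>\<mu>\<in>Spec A a. \<forall>x\<in>eigenspace A a \<kappa>. \<forall>y\<in>eigenspace A a \<mu>.
        alg_mult A x y \<in> eigenspaces A a (star \<kappa> \<mu>))"

definition axial_algebra ::
  "'f::field set \<Rightarrow> ('f \<Rightarrow> 'f \<Rightarrow> 'f set) \<Rightarrow> ('f, 'a::ab_group_add) alg \<Rightarrow> 'a set \<Rightarrow> bool"
where
  "axial_algebra F star A X \<longleftrightarrow>
     comm_algebra A \<and> finite X \<and> (\<forall>a\<in>X. axis F star A a) \<and> generates A X"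

definition minimal_generating_axes ::
  "'f::field set \<Rightarrow> ('f \<Rightarrow> 'f \<Rightarrow> 'f set) \<Rightarrow> ('f, 'a::ab_group_add) alg \<Rightarrow> 'a set \<Rightarrow> bool"
where
  "minimal_generating_axes F star A X \<longleftrightarrow>
     (\<forall>a\<in>X. axis F star A a) \<and> generates A X \<and> (\<forall>Z. Z \<subset> X \<longrightarrow> \<not> generates A Z)"

text \<open>
  \<open>V\<close> is a subspace of a type with scalar multiplication \<open>t\<close>. The finite set \<open>T\<close> and the family
  \<open>z\<close> in the second condition express the decomposition of \<open>xy\<close> into its (finitely many non-zero)
  components in the eigenspaces for \<open>\<kappa> \<star> \<mu>\<close>, which may be infinite. When \<open>a\<close> is an axis such a
  decomposition exists and is unique up to zero components.
\<close>

definition cocycles ::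
  "('f::field \<Rightarrow> 'f \<Rightarrow> 'f set) \<Rightarrow> ('f, 'a::ab_group_add) alg
     \<Rightarrow> ('f \<Rightarrow> 'v::ab_group_add \<Rightarrow> 'v) \<Rightarrow> 'v set \<Rightarrow> 'a set \<Rightarrow> ('a \<Rightarrow> 'a \<Rightarrow> 'v) set"
where
  "cocycles star A t V X = {\<theta>.
     (\<forall>x\<in>alg_carrier A. \<forall>y\<in>alg_carrier A. \<theta> x y \<in> V \<and> \<theta> x y = \<theta> y x) \<and>
     bilinear_map_on (alg_scale A) t (alg_carrier A) \<theta> \<and>
     (\<forall>a\<in>X.
        {y \<in> alg_carrier A. alg_mult A a y = 0} \<subseteq> {y \<in> alg_carrier A. \<theta> a y = 0} \<and>
        (\<forall>\<kappa>\<in>Spec A a. \<forall>\<mu>\<in>Spec A a. 0 \<notin> star \<kappa> \<mu> \<longrightarrow>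
           (\<forall>x\<in>eigenspace A a \<kappa>. \<forall>y\<in>eigenspace A a \<mu>. \<forall>T z.
              finite T \<and> T \<subseteq> star \<kappa> \<mu> \<and> (\<forall>\<nu>\<in>T. z \<nu> \<in> eigenspace A a \<nu>) \<and>
              alg_mult A x y = (\<Sum>\<nu>\<in>T. z \<nu>) \<longrightarrow>
              \<theta> x y = (\<Sum>\<nu>\<in>T. t (inverse \<nu>) (\<theta> a (z \<nu>))))))}"

definition central_extension ::
  "('f::field, 'a::ab_group_add) alg \<Rightarrow> ('f \<Rightarrow> 'v::ab_group_add \<Rightarrow> 'v) \<Rightarrow> 'v set
     \<Rightarrow> ('a \<Rightarrow> 'a \<Rightarrow> 'v) \<Rightarrow> ('f, 'a \<times> 'v) alg"
where
  "central_extension A t V \<theta> =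
     \<lparr>alg_carrier = alg_carrier A \<times> V,
      alg_scale = module_prod.scale (alg_scale A) t,
      alg_mult = (\<lambda>p q. (alg_mult A (fst p) (fst q), \<theta> (fst p) (fst q)))\<rparr>"

text \<open>
  The equality \<open>B = A\<^sub>\<theta>\<close>: an algebra isomorphism from the extension of \<open>A\<close> by \<open>annihilator B\<close>
  onto \<open>B\<close> that is the identity on \<open>annihilator B\<close>.
\<close>

definition is_central_extension ::
  "('f::field, 'b::ab_group_add) alg \<Rightarrow> ('f, 'a::ab_group_add) alg \<Rightarrow> ('a \<Rightarrow> 'a \<Rightarrow> 'b) \<Rightarrow> bool"
where
  "is_central_extension B A \<theta> \<longleftrightarrow>
     (\<exists>\<phi>. alg_iso (central_extension A (alg_scale B) (annihilator B) \<theta>) B \<phi> \<and>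
          (\<forall>v\<in>annihilator B. \<phi> (0, v) = v))"

end

theory Submission
  imports Defs
begin

text \<open>
  An element \<open>a\<close> is semisimple iff the algebra is spanned by its eigenvectors, because a subspace
  stable under \<open>L\<^sub>a\<close> contains the eigencomponents of its elements. Choose a linear projection \<open>q\<close>
  onto \<open>Ann(B)\<close>, put \<open>p = id - q\<close>, and give the complement \<open>ker q\<close> the product \<open>p(xy)\<close>; the
  cocycle is \<open>q(xy)\<close>. Then \<open>p\<close> is a surjective homomorphism with kernel \<open>Ann(B)\<close>, eigenvectors
  of \<open>p(a)\<close> lift to eigenvectors of \<open>a\<close>, and so axes map to axes.
\<close>

section \<open>Commutative algebras: eigenspaces, semisimple elements, subalgebras\<close>

locale commutative_algebra =
  fixes A :: "('f::field, 'a::ab_group_add) alg"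
  assumes comm_algebra: "comm_algebra A"
begin

abbreviation "C \<equiv> alg_carrier A"

abbreviation scl (infixr "*a" 75) where "c *a x \<equiv> alg_scale A c x"

abbreviation mul (infixl "\<cdot>" 70) where "x \<cdot> y \<equiv> alg_mult A x y"

sublocale vector_space "alg_scale A"
  using comm_algebra unfolding comm_algebra_def by blast

lemma subspace_carrier: "subspace C"
  using comm_algebra unfolding comm_algebra_def by blast

lemmas carrier_0 [simp] = subspace_0[OF subspace_carrier]
  and carrier_add [simp] = subspace_add[OF subspace_carrier]
  and carrier_diff [simp] = subspace_diff[OF subspace_carrier]
  and carrier_scale [simp] = subspace_scale[OF subspace_carrier]
  and carrier_sum = subspace_sum[OF subspace_carrier]

lemma mult_closed [simp]: "x \<in> C \<Longrightarrow> y \<in> C \<Longrightarrow> x \<cdot> y \<in> C"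
  using comm_algebra unfolding comm_algebra_def by blast

lemma mult_commute: "x \<in> C \<Longrightarrow> y \<in> C \<Longrightarrow> x \<cdot> y = y \<cdot> x"
  using comm_algebra unfolding comm_algebra_def by blast

lemma mult_add_right: "x \<in> C \<Longrightarrow> y \<in> C \<Longrightarrow> z \<in> C \<Longrightarrow> x \<cdot> (y + z) = x \<cdot> y + x \<cdot> z"
  using comm_algebra
  unfolding comm_algebra_def bilinear_map_on_def linear_map_on_def by blast

lemma mult_scale_right: "x \<in> C \<Longrightarrow> y \<in> C \<Longrightarrow> x \<cdot> (c *a y) = c *a (x \<cdot> y)"
  using comm_algebra
  unfolding comm_algebra_def bilinear_map_on_def linear_map_on_def by blast

lemma mult_add_left: "x \<in> C \<Longrightarrow> y \<in> C \<Longrightarrow> z \<in> C \<Longrightarrow> (y + z) \<cdot> x = y \<cdot> x + z \<cdot> x"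
  using mult_add_right[of x y z] by (simp add: mult_commute)

lemma mult_scale_left: "x \<in> C \<Longrightarrow> y \<in> C \<Longrightarrow> (c *a y) \<cdot> x = c *a (y \<cdot> x)"
  using mult_scale_right[of x y c] by (simp add: mult_commute)

lemma mult_0_right [simp]: "x \<in> C \<Longrightarrow> x \<cdot> 0 = 0"
  using mult_scale_right[of x 0 0] by simp

lemma mult_diff_right: "x \<in> C \<Longrightarrow> y \<in> C \<Longrightarrow> z \<in> C \<Longrightarrow> x \<cdot> (y - z) = x \<cdot> y - x \<cdot> z"
  using mult_add_right[of x "y - z" z] by (simp add: algebra_simps)

lemma mult_sum_right:
  assumes "x \<in> C" "\<And>i. i \<in> T \<Longrightarrow> e i \<in> C"
  shows "x \<cdot> sum e T = (\<Sum>i\<in>T. x \<cdot> e i)"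
  using assms(2)
proof (induction T rule: infinite_finite_induct)
  case (insert i T)
  then show ?case using assms(1) by (simp add: mult_add_right carrier_sum)
qed (use assms(1) in auto)

lemma subspace_eigenspace: "x \<in> C \<Longrightarrow> subspace (eigenspace A x \<kappa>)"
  unfolding subspace_def eigenspace_def
  by (auto simp: mult_add_right mult_scale_right scale_right_distrib scale_left_commute)

lemma eigenspaces_subset_carrier: "x \<in> C \<Longrightarrow> eigenspaces A x S \<subseteq> C"
  unfolding eigenspaces_def
  by (rule span_minimal[OF _ subspace_carrier]) (auto simp: eigenspace_def)

text \<open>Vandermonde-style elimination: applying \<open>L_x - \<kappa>\<close> to the sum removes
  the \<open>\<kappa>\<close>-component and rescales each other component by a nonzero factor
  \<open>i - \<kappa>\<close>. The result stays in \<open>W\<close> and has one summand fewer. The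
  induction leaves \<open>e\<close> arbitrary because the components get rescaled.\<close>

lemma stable_contains_eigencomponents:
  assumes x: "x \<in> C" and W: "subspace W" "W \<subseteq> C" "\<And>y. y \<in> W \<Longrightarrow> x \<cdot> y \<in> W"
    and "finite T" "\<And>\<nu>. \<nu> \<in> T \<Longrightarrow> e \<nu> \<in> eigenspace A x \<nu>" "sum e T \<in> W" "\<nu> \<in> T"
  shows "e \<nu> \<in> W"
  using assms(5-)
proof (induction T arbitrary: e \<nu> rule: finite_induct)
  case (insert \<kappa> T)
  have eC: "e i \<in> C" "x \<cdot> e i = i *a e i" if "i \<in> insert \<kappa> T" for i
    using insert.prems(1)[OF that] by (auto simp: eigenspace_def)
  let ?w = "sum e (insert \<kappa> T)"
  have "x \<cdot> ?w - \<kappa> *a ?w = (\<Sum>i\<in>insert \<kappa> T. x \<cdot> e i - \<kappa> *a e i)"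
    by (simp only: mult_sum_right[OF x eC(1)] scale_sum_right sum_subtractf)
  also have "\<dots> = (\<Sum>i\<in>insert \<kappa> T. (i - \<kappa>) *a e i)"
    by (rule sum.cong) (simp_all only: eC scale_left_diff_distrib)
  also have "\<dots> = (\<Sum>i\<in>T. (i - \<kappa>) *a e i)"
    using insert.hyps by simp
  finally have sum_in: "(\<Sum>i\<in>T. (i - \<kappa>) *a e i) \<in> W"
    using W insert.prems(2) by (metis subspace_diff subspace_scale)
  have in_W: "e i \<in> W" if i: "i \<in> T" for i
  proof -
    have "(i - \<kappa>) *a e i \<in> W"
      using insert.IH[OF _ sum_in i] insert.prems(1) subspace_scale[OF subspace_eigenspace[OF x]]
      by blast
    then have "inverse (i - \<kappa>) *a ((i - \<kappa>) *a e i) \<in> W"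
      using W subspace_scale by blast
    moreover have "i \<noteq> \<kappa>" using i insert.hyps by blast
    ultimately show ?thesis by simp
  qed
  moreover have "e \<kappa> = ?w - sum e T" using insert.hyps by simp
  \<comment> \<open>The eliminated component is the original sum minus the components already placed
    in \<open>W\<close>.\<close>
  ultimately have "e \<kappa> \<in> W"
    using W insert.prems(2) by (metis subspace_diff subspace_sum)
  with in_W insert.prems(3) show ?case by blast
qed simp

text \<open>Collects the terms of a linear combination by eigenvalue, so that each eigenvalue
  carries a single eigenvector and elimination of components applies.\<close>

lemma eigenspaces_decompose:
  assumes "x \<in> C" "y \<in> eigenspaces A x S"
  obtains T e where "finite T" "T \<subseteq> S" "\<And>\<nu>. e \<nu> \<in> eigenspace A x \<nu>" "y = sum e T"
proof -
  \<comment> \<open>The induction also asks that \<open>e\<close> vanish outside \<open>T\<close>,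
    so that inserting a possibly new eigenvalue into \<open>T\<close> does not change the
    sum.\<close>
  have "\<exists>T e. finite T \<and> T \<subseteq> S \<and> (\<forall>\<nu>. e \<nu> \<in> eigenspace A x \<nu> \<and> (\<nu> \<notin> T \<longrightarrow> e \<nu> = 0))
      \<and> y = sum e T"
    using assms(2) unfolding eigenspaces_def
  proof (induction rule: span_induct_alt)
    case base
    show ?case
      using assms(1) by (intro exI[of _ "{}"] exI[of _ "\<lambda>_. 0"]) (simp add: eigenspace_def)
  next
    case (step c u y)
    then obtain T e where T: "finite T" "T \<subseteq> S" "y = sum e T"
      "\<And>\<nu>. e \<nu> \<in> eigenspace A x \<nu>" "\<And>\<nu>. \<nu> \<notin> T \<Longrightarrow> e \<nu> = 0" by blast
    from step obtain \<kappa> where \<kappa>: "\<kappa> \<in> S" "u \<in> eigenspace A x \<kappa>" by blast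
    \<comment> \<open>Adding the new term to the \<open>\<kappa>\<close>-component treats
      \<open>\<kappa> \<in> T\<close> and \<open>\<kappa> \<notin> T\<close> alike.\<close>
    let ?e = "\<lambda>\<nu>. (if \<nu> = \<kappa> then c *a u else 0) + e \<nu>"
    have "sum ?e (insert \<kappa> T) = c *a u + sum e (insert \<kappa> T)"
      using T(1) by (simp only: sum.distrib sum.delta' sum.delta finite_insert) simp
    also have "sum e (insert \<kappa> T) = sum e T"
      using T by (cases "\<kappa> \<in> T") (auto simp: insert_absorb)
    finally have "c *a u + y = sum ?e (insert \<kappa> T)" using T by simp
    moreover have "?e \<nu> \<in> eigenspace A x \<nu>" for \<nu>
      using T(4)[of \<nu>] \<kappa> subspace_eigenspace[OF assms(1)]
      by (auto intro: subspace_add subspace_scale)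
    ultimately show ?case
      using T \<kappa> by (intro exI[of _ "insert \<kappa> T"] exI[of _ ?e]) auto
  qed
  then show thesis using that by blast
qed

text \<open>Replaces the quantification over finite-dimensional stable subspaces by a spanning
  condition, which passes to homomorphic images.\<close>

lemma semisimple_iff_eigenspaces_UNIV:
  assumes x: "x \<in> C"
  shows "semisimple A x \<longleftrightarrow> C \<subseteq> eigenspaces A x UNIV"
proof
  assume ss: "semisimple A x"
  show "C \<subseteq> eigenspaces A x UNIV"
  proof
    fix y assume "y \<in> C"
    with ss obtain W where W: "fin_dim_stable A x W" "y \<in> W"
      unfolding semisimple_def by blast
    with ss obtain E where E: "span E = W" "\<And>e. e \<in> E \<Longrightarrow> \<exists>c. x \<cdot> e = c *a e"
      unfolding semisimple_def diagonalisable_on_def by blast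
    have "E \<subseteq> C" using E(1) W(1) span_superset unfolding fin_dim_stable_def by blast
    then have "E \<subseteq> (\<Union>\<kappa>\<in>UNIV. eigenspace A x \<kappa>)"
      using E(2) by (fastforce simp: eigenspace_def)
    then show "y \<in> eigenspaces A x UNIV"
      using W(2) E(1) span_mono unfolding eigenspaces_def by blast
  qed
next
  assume sp: "C \<subseteq> eigenspaces A x UNIV"
  have "\<exists>W. fin_dim_stable A x W \<and> y \<in> W" if "y \<in> C" for y
  proof -
    from sp that have "y \<in> eigenspaces A x UNIV" by blast
    then obtain T e where T: "finite T" "\<And>\<nu>. e \<nu> \<in> eigenspace A x \<nu>" "y = sum e T"
      by (rule eigenspaces_decompose[OF x]) (rule that)
    \<comment> \<open>The finitely many eigencomponents of \<open>y\<close> span a stable subspace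
      containing \<open>y\<close>.\<close>
    let ?W = "span (e ` T)"
    have eC: "e \<nu> \<in> C" "x \<cdot> e \<nu> = \<nu> *a e \<nu>" for \<nu> using T(2)[of \<nu>] by (auto simp: eigenspace_def)
    have WC: "?W \<subseteq> C" by (rule span_minimal[OF _ subspace_carrier]) (use eC in blast)
    have "z \<in> C \<and> x \<cdot> z \<in> ?W" if "z \<in> ?W" for z
      using that
    proof (induction rule: span_induct_alt)
      case (step c u z)
      then obtain \<nu> where "\<nu> \<in> T" "u = e \<nu>" by blast
      with step x eC show ?case
        by (auto simp: mult_add_right mult_scale_right simp del: scale_scale
            intro!: span_add[OF span_scale[OF span_scale[OF span_base]]])
    qed (simp add: x span_zero)
    then have "fin_dim_stable A x ?W"
      unfolding fin_dim_stable_def using WC T(1) by blast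
    moreover have "y \<in> ?W" unfolding T(3) by (intro span_sum span_base) blast
    ultimately show ?thesis by blast
  qed
  moreover have "diagonalisable_on (alg_scale A) W (alg_mult A x)" if W: "fin_dim_stable A x W" for W
  proof -
    from W have WC: "W \<subseteq> C" "subspace W" "\<And>y. y \<in> W \<Longrightarrow> x \<cdot> y \<in> W"
      unfolding fin_dim_stable_def by auto
    \<comment> \<open>By stability, \<open>W\<close> contains the eigencomponents of its elements,
      so its eigenvectors span it; a maximal independent set of them is the diagonalising
      basis.\<close>
    let ?D = "{e \<in> W. \<exists>c. x \<cdot> e = c *a e}"
    have "W \<subseteq> span ?D"
    proof
      fix w assume w: "w \<in> W"
      with sp WC have "w \<in> eigenspaces A x UNIV" by blast
      then obtain T e where T: "finite T" "\<And>\<nu>. e \<nu> \<in> eigenspace A x \<nu>" "w = sum e T"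
        by (rule eigenspaces_decompose[OF x]) (rule that)
      have "e \<nu> \<in> ?D" if "\<nu> \<in> T" for \<nu>
        using stable_contains_eigencomponents[OF x WC(2,1,3) T(1) T(2) _ that] w T(2)[of \<nu>] T(3)
        by (auto simp: eigenspace_def)
      then show "w \<in> span ?D" unfolding T(3) by (intro span_sum span_base) blast
    qed
    then have D: "span ?D = W" using span_minimal[OF _ WC(2), of ?D] by blast
    obtain E where E: "E \<subseteq> ?D" "independent E" "?D \<subseteq> span E"
      using maximal_independent_subset by blast
    then have "span E = W"
      using D span_mono[OF E(1)] span_minimal[OF E(3) subspace_span] by blast
    then show ?thesis
      unfolding diagonalisable_on_def using E(1,2) by blast
  qed
  ultimately show "semisimple A x" unfolding semisimple_def by blast
qed

text \<open>The kernel of \<open>L_x\<close> squared is stable, so it contains each eigencomponent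
  of \<open>y\<close>. There the square acts as multiplication by the square of the eigenvalue, so
  either the eigenvalue or the component is zero.\<close>

lemma semisimple_kernel_square:
  assumes x: "x \<in> C" "semisimple A x" and y: "y \<in> C" "x \<cdot> (x \<cdot> y) = 0"
  shows "x \<cdot> y = 0"
proof -
  from x y have "y \<in> eigenspaces A x UNIV" using semisimple_iff_eigenspaces_UNIV by blast
  then obtain T e where T: "finite T" "\<And>\<nu>. e \<nu> \<in> eigenspace A x \<nu>" "y = sum e T"
    by (rule eigenspaces_decompose[OF x(1)]) (rule that)
  have eC: "e \<nu> \<in> C" "x \<cdot> e \<nu> = \<nu> *a e \<nu>" for \<nu> using T(2)[of \<nu>] by (auto simp: eigenspace_def)
  let ?W = "{z \<in> C. x \<cdot> (x \<cdot> z) = 0}"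
  have W: "subspace ?W"
    unfolding subspace_def using x by (auto simp: mult_add_right mult_scale_right)
  have "x \<cdot> e \<nu> = 0" if "\<nu> \<in> T" for \<nu>
  proof -
    have "e \<nu> \<in> ?W"
      by (rule stable_contains_eigencomponents[OF x(1) W _ _ T(1) T(2) _ that]) (use T(3) x y in auto)
    then show ?thesis using eC x(1) by (auto simp: mult_scale_right)
  qed
  then show ?thesis unfolding T(3) mult_sum_right[OF x(1) eC(1)] by (intro sum.neutral ballI)
qed

text \<open>The kernel of \<open>L_x\<close> is stable and so contains the components of
  \<open>y\<close>; on each of them \<open>L_x\<close> is a nonzero scalar.\<close>

lemma eigenspaces_nonzero_kernel:
  assumes x: "x \<in> C" and S: "0 \<notin> S" "y \<in> eigenspaces A x S" and y: "x \<cdot> y = 0"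
  shows "y = 0"
proof -
  from x S obtain T e where T: "finite T" "T \<subseteq> S" "\<And>\<nu>. e \<nu> \<in> eigenspace A x \<nu>" "y = sum e T"
    using eigenspaces_decompose by blast
  let ?W = "{z \<in> C. x \<cdot> z = 0}"
  have W: "subspace ?W"
    unfolding subspace_def using x by (auto simp: mult_add_right mult_scale_right)
  have yC: "y \<in> C" using eigenspaces_subset_carrier[OF x] S by blast
  have "e \<nu> = 0" if "\<nu> \<in> T" for \<nu>
  proof -
    have "e \<nu> \<in> ?W"
      by (rule stable_contains_eigencomponents[OF x W _ _ T(1) T(3) _ that]) (use T(4) x y yC in auto)
    then show ?thesis using T(2) T(3)[of \<nu>] S(1) that by (auto simp: eigenspace_def)
  qed
  then show ?thesis unfolding T(4) by simp
qed

lemma is_subalgebra_hull: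
  assumes "X \<subseteq> C"
  shows "is_subalgebra A (is_subalgebra A hull X)" "is_subalgebra A hull X \<subseteq> C"
proof -
  \<comment> \<open>As \<open>C\<close> is one of the subalgebras being intersected, the hull stays
    inside \<open>C\<close>.\<close>
  have C: "is_subalgebra A C" unfolding is_subalgebra_def using subspace_carrier by simp
  then show sub: "is_subalgebra A hull X \<subseteq> C" using assms by (simp add: hull_minimal)
  have "subspace (is_subalgebra A hull X)"
    unfolding hull_def by (rule subspace_Inter) (auto simp: is_subalgebra_def)
  moreover have "x \<cdot> y \<in> is_subalgebra A hull X"
    if "x \<in> is_subalgebra A hull X" "y \<in> is_subalgebra A hull X" for x y
    using that unfolding hull_def by (auto simp: is_subalgebra_def)
  ultimately show "is_subalgebra A (is_subalgebra A hull X)"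
    using sub unfolding is_subalgebra_def by blast
qed

end

section \<open>The quotient by the annihilator, realised on a complement\<close>

locale annihilator_projection = commutative_algebra A
  for A :: "('f::field, 'a::ab_group_add) alg" +
  fixes q :: "'a \<Rightarrow> 'a"
  assumes q_add: "q (x + y) = q x + q y"
    and q_scale: "q (alg_scale A c x) = alg_scale A c (q x)"
    and q_annihilator [simp]: "q x \<in> annihilator A"
    and q_id: "v \<in> annihilator A \<Longrightarrow> q v = v"
begin

definition p :: "'a \<Rightarrow> 'a" where "p x = x - q x"

text \<open>A model of the quotient by the annihilator that stays in the type of \<open>A\<close>
  and keeps its scalar multiplication.\<close>

definition Q :: "('f, 'a) alg" where
  "Q = \<lparr>alg_carrier = {x \<in> C. q x = 0}, alg_scale = alg_scale A, alg_mult = \<lambda>x y. p (x \<cdot> y)\<rparr>"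

lemma q_q [simp]: "q (q x) = q x"
  by (simp add: q_id)

lemma q_0 [simp]: "q 0 = 0"
  using q_scale[of 0 0] by simp

lemma q_diff: "q (x - y) = q x - q y"
  using q_add[of "x - y" y] by (simp add: algebra_simps)

lemma q_carrier [simp]: "q x \<in> C"
  using q_annihilator[of x] unfolding annihilator_def by blast

lemma p_0 [simp]: "p 0 = 0"
  by (simp add: p_def)

lemma p_add: "p (x + y) = p x + p y"
  by (simp add: p_def q_add)

lemma p_scale: "p (c *a x) = c *a p x"
  by (simp add: p_def q_scale scale_right_diff_distrib)

lemma p_diff: "p (x - y) = p x - p y"
  by (simp add: p_def q_diff)

lemma p_sum: "p (sum e T) = (\<Sum>i\<in>T. p (e i))"
  by (induction T rule: infinite_finite_induct) (auto simp: p_add)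

lemma q_sum: "q (sum e T) = (\<Sum>i\<in>T. q (e i))"
  by (induction T rule: infinite_finite_induct) (auto simp: q_add)

lemma p_q [simp]: "p (q x) = 0"
  by (simp add: p_def)

lemma q_p [simp]: "q (p x) = 0"
  by (simp add: p_def q_diff)

lemma p_plus_q: "p x + q x = x"
  by (simp add: p_def)

lemma p_carrier [simp]: "x \<in> C \<Longrightarrow> p x \<in> C"
  by (simp add: p_def)

lemma p_eq_0_iff: "p x = 0 \<longleftrightarrow> x \<in> annihilator A"
  unfolding p_def by (metis eq_iff_diff_eq_0 q_annihilator q_id)

lemma annihilator_mult [simp]:
  assumes "v \<in> annihilator A" "x \<in> C"
  shows "v \<cdot> x = 0" "x \<cdot> v = 0"
  using assms mult_commute[of x v] unfolding annihilator_def by auto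

lemma annihilator_carrier: "v \<in> annihilator A \<Longrightarrow> v \<in> C"
  unfolding annihilator_def by blast

text \<open>\<open>p y\<close> and \<open>y\<close> differ by an element of the annihilator.
  Together with the left version this makes \<open>p\<close> a homomorphism from \<open>A\<close> to
  \<open>Q\<close>.\<close>

lemma mult_p_right [simp]: "x \<in> C \<Longrightarrow> y \<in> C \<Longrightarrow> x \<cdot> p y = x \<cdot> y"
  by (simp add: p_def mult_diff_right)

lemma mult_p_left [simp]: "x \<in> C \<Longrightarrow> y \<in> C \<Longrightarrow> p x \<cdot> y = x \<cdot> y"
  using mult_p_right[of y x] by (simp add: mult_commute)

lemma Q_simps [simp]:
  "alg_scale Q = alg_scale A" "alg_mult Q x y = p (x \<cdot> y)"
  by (simp_all add: Q_def)

lemma mem_carrier_Q: "x \<in> alg_carrier Q \<longleftrightarrow> x \<in> C \<and> q x = 0"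
  by (simp add: Q_def)

lemma p_mem_carrier_Q [simp]: "x \<in> C \<Longrightarrow> p x \<in> alg_carrier Q"
  by (simp add: mem_carrier_Q)

lemma p_carrier_Q: "x \<in> alg_carrier Q \<Longrightarrow> p x = x"
  by (simp add: mem_carrier_Q p_def)

lemma comm_algebra_Q: "comm_algebra Q"
  unfolding comm_algebra_def bilinear_map_on_def linear_map_on_def Q_simps
  using vector_space_axioms
  by (auto simp: mem_carrier_Q subspace_def q_add q_scale mult_add_right mult_add_left
      mult_scale_right mult_scale_left p_add p_scale mult_commute)

text \<open>The rewrite lets \<open>A\<close> and \<open>Q\<close> share the same
  \<open>subspace\<close> and \<open>span\<close>.\<close>

sublocale Q: commutative_algebra Q
  rewrites "alg_scale Q = alg_scale A"
  by unfold_locales (simp_all add: comm_algebra_Q)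

section \<open>Eigenvectors and axes of the quotient\<close>

lemma p_eigenspace:
  assumes "a \<in> C" "y \<in> eigenspace A a \<kappa>"
  shows "p y \<in> eigenspace Q (p a) \<kappa>"
  using assms by (auto simp: eigenspace_def p_scale)

lemma p_eigenspaces:
  assumes "a \<in> C" "y \<in> eigenspaces A a S"
  shows "p y \<in> eigenspaces Q (p a) S"
proof -
  from assms obtain T e where T: "finite T" "T \<subseteq> S" "\<And>\<nu>. e \<nu> \<in> eigenspace A a \<nu>" "y = sum e T"
    using eigenspaces_decompose by blast
  show ?thesis
    unfolding T(4) p_sum eigenspaces_def Q_simps
    by (intro span_sum span_base) (use T p_eigenspace[OF assms(1)] in blast)
qed

text \<open>In \<open>A\<close>, \<open>a \<cdot> x\<close> equals \<open>\<kappa> *a x\<close> plus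
  the error \<open>q (a \<cdot> x)\<close>. The correction is killed by \<open>L_a\<close>, and for
  nonzero \<open>\<kappa>\<close> its multiple by \<open>\<kappa>\<close> is exactly this error. For
  \<open>\<kappa> = 0\<close> the convention \<open>inverse 0 = 0\<close> makes the correction
  vanish; then \<open>a \<cdot> x\<close> lies in the annihilator, and semisimplicity forces it to
  be zero.\<close>

lemma eigenspace_lift:
  assumes a: "a \<in> C" "semisimple A a" and x: "x \<in> eigenspace Q (p a) \<kappa>"
  shows "x + inverse \<kappa> *a q (a \<cdot> x) \<in> eigenspace A a \<kappa>"
proof -
  have xC: "x \<in> C" "q x = 0" and ax: "p (a \<cdot> x) = \<kappa> *a x"
    using x a(1) by (auto simp: eigenspace_def mem_carrier_Q)
  have eq: "a \<cdot> x = \<kappa> *a x + q (a \<cdot> x)" using p_plus_q[of "a \<cdot> x"] ax by simp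
  have "a \<cdot> x = \<kappa> *a (x + inverse \<kappa> *a q (a \<cdot> x))"
  proof (cases "\<kappa> = 0")
    case True
    then have "a \<cdot> (a \<cdot> x) = a \<cdot> q (a \<cdot> x)" using eq by simp
    then have "a \<cdot> x = 0" using semisimple_kernel_square[OF a xC(1)] a by simp
    then show ?thesis using True by simp
  next
    case False
    then show ?thesis using eq by (simp add: scale_right_distrib)
  qed
  then show ?thesis using xC a by (simp add: eigenspace_def mult_add_right mult_scale_right)
qed

lemma p_lift: "x \<in> eigenspace Q b \<kappa> \<Longrightarrow> p (x + c *a q y) = x"
  by (auto simp: p_add p_scale eigenspace_def p_carrier_Q)

text \<open>A lifted eigenvector is nonzero because \<open>p\<close> recovers the original from it.
  The inclusion can be strict: all eigenvectors for 0 may lie in the annihilator.\<close>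

lemma Spec_Q_subset:
  assumes "a \<in> C" "semisimple A a"
  shows "Spec Q (p a) \<subseteq> Spec A a"
proof
  fix \<kappa> assume "\<kappa> \<in> Spec Q (p a)"
  then obtain x where x: "x \<in> eigenspace Q (p a) \<kappa>" "x \<noteq> 0"
    by (auto simp: Spec_def eigenspace_def)
  have "x + inverse \<kappa> *a q (a \<cdot> x) \<noteq> 0"
    using p_lift[OF x(1)] x(2) by (metis p_q q_0)
  with eigenspace_lift[OF assms x(1)] show "\<kappa> \<in> Spec A a"
    by (auto simp: Spec_def eigenspace_def)
qed

lemma axis_Q:
  assumes "axis F star A a"
  shows "axis F star Q (p a)"
proof -
  from assms have a: "a \<in> C" "a \<noteq> 0" "a \<cdot> a = a" "semisimple A a" "Spec A a \<subseteq> F"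
    and fus: "\<And>\<kappa> \<mu> x y. \<kappa> \<in> Spec A a \<Longrightarrow> \<mu> \<in> Spec A a \<Longrightarrow> x \<in> eigenspace A a \<kappa> \<Longrightarrow>
      y \<in> eigenspace A a \<mu> \<Longrightarrow> x \<cdot> y \<in> eigenspaces A a (star \<kappa> \<mu>)"
    unfolding axis_def by auto
  \<comment> \<open>An idempotent in the annihilator would be
    \<open>a = a \<cdot> a = 0\<close>.\<close>
  have "p a \<noteq> 0" using a p_eq_0_iff annihilator_mult(1)[of a a] by auto
  moreover have "semisimple Q (p a)"
  proof -
    have "alg_carrier Q \<subseteq> eigenspaces Q (p a) UNIV"
    proof
      fix y assume y: "y \<in> alg_carrier Q"
      then have "y \<in> eigenspaces A a UNIV"
        using a semisimple_iff_eigenspaces_UNIV[OF a(1)] mem_carrier_Q by blast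
      from p_eigenspaces[OF a(1) this] show "y \<in> eigenspaces Q (p a) UNIV"
        using p_carrier_Q[OF y] by simp
    qed
    then show ?thesis using a(1) Q.semisimple_iff_eigenspaces_UNIV by simp
  qed
  moreover have "p (x \<cdot> y) \<in> eigenspaces Q (p a) (star \<kappa> \<mu>)"
    if "\<kappa> \<in> Spec Q (p a)" "\<mu> \<in> Spec Q (p a)" "x \<in> eigenspace Q (p a) \<kappa>" "y \<in> eigenspace Q (p a) \<mu>"
    for \<kappa> \<mu> x y
  proof -
    \<comment> \<open>The fusion law of \<open>A\<close> applies to the lifts, whose product is
      still \<open>x \<cdot> y\<close> since the corrections annihilate; \<open>p\<close> then
      carries the conclusion to \<open>Q\<close>.\<close>
    let ?x = "x + inverse \<kappa> *a q (a \<cdot> x)" and ?y = "y + inverse \<mu> *a q (a \<cdot> y)"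
    have "?x \<cdot> ?y \<in> eigenspaces A a (star \<kappa> \<mu>)"
      using fus that Spec_Q_subset[OF a(1,4)] eigenspace_lift[OF a(1,4)] by blast
    moreover have "x \<in> C" "y \<in> C" using that by (auto simp: eigenspace_def mem_carrier_Q)
    then have "?x \<cdot> ?y = x \<cdot> y" by (simp add: mult_add_left mult_add_right mult_scale_left mult_scale_right)
    ultimately show ?thesis using p_eigenspaces[OF a(1)] by metis
  qed
  ultimately show ?thesis
    unfolding axis_def using a Spec_Q_subset[OF a(1,4)] by auto
qed

section \<open>Generating sets of the quotient and minimality\<close>

lemma generates_Q:
  assumes "generates A Y"
  shows "generates Q (p ` Y)"
proof -
  from assms have YC: "Y \<subseteq> C" and hull: "is_subalgebra A hull Y = C"
    unfolding generates_def by auto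
  have X: "p ` Y \<subseteq> alg_carrier Q" using YC by auto
  define H where "H = is_subalgebra Q hull (p ` Y)"
  have sub: "is_subalgebra Q H" and H_le: "H \<subseteq> alg_carrier Q" and X_le: "p ` Y \<subseteq> H"
    unfolding H_def using Q.is_subalgebra_hull[OF X] by (auto intro: hull_inc)
  have H: "subspace H" "\<And>x y. x \<in> H \<Longrightarrow> y \<in> H \<Longrightarrow> p (x \<cdot> y) \<in> H"
    using sub unfolding is_subalgebra_def by auto
  \<comment> \<open>The preimage of \<open>H\<close> under the homomorphism \<open>p\<close> is a
    subalgebra containing \<open>Y\<close>, hence all of \<open>C\<close>.\<close>
  have "is_subalgebra A {x \<in> C. p x \<in> H}"
    unfolding is_subalgebra_def
  proof (intro conjI ballI)
    show "subspace {x \<in> C. p x \<in> H}"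
      using H(1) unfolding subspace_def by (auto simp: p_add p_scale)
    fix x y assume "x \<in> {x \<in> C. p x \<in> H}" "y \<in> {x \<in> C. p x \<in> H}"
    then show "x \<cdot> y \<in> {x \<in> C. p x \<in> H}" using H(2)[of "p x" "p y"] by simp
  qed auto
  moreover have "Y \<subseteq> {x \<in> C. p x \<in> H}" using YC X_le by auto
  ultimately have "is_subalgebra A hull Y \<subseteq> {x \<in> C. p x \<in> H}" by (rule hull_minimal[rotated])
  then have "C \<subseteq> {x \<in> C. p x \<in> H}" using hull by simp
  then have "alg_carrier Q \<subseteq> H" using p_carrier_Q mem_carrier_Q by force
  then show ?thesis unfolding generates_def using X H_le unfolding H_def by blast
qed

text \<open>
  The lifted set generates a subalgebra \<open>S\<close> with \<open>S + Ann(A) = A\<close>, so all products of \<open>A\<close> are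
  products of elements of \<open>S\<close>; in particular \<open>S\<close> contains every idempotent.
\<close>

lemma generates_lift:
  assumes Y: "generates A Y" "\<And>a. a \<in> Y \<Longrightarrow> a \<cdot> a = a"
    and Z: "Z \<subseteq> Y" "generates Q (p ` Z)"
  shows "generates A Z"
proof -
  from Y have YC: "Y \<subseteq> C" and hull: "is_subalgebra A hull Y = C"
    unfolding generates_def by auto
  then have ZC: "Z \<subseteq> C" using Z(1) by blast
  define S where "S = is_subalgebra A hull Z"
  have S: "is_subalgebra A S" and SC: "S \<subseteq> C" and ZS: "Z \<subseteq> S"
    unfolding S_def using is_subalgebra_hull[OF ZC] by (auto intro: hull_inc)
  then have S': "subspace S" "\<And>x y. x \<in> S \<Longrightarrow> y \<in> S \<Longrightarrow> x \<cdot> y \<in> S"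
    unfolding is_subalgebra_def by auto
  have "is_subalgebra Q (p ` S)"
    unfolding is_subalgebra_def Q_simps
  proof (intro conjI ballI)
    show "p ` S \<subseteq> alg_carrier Q" using SC by auto
    show "subspace (p ` S)"
    proof (rule subspaceI)
      show "0 \<in> p ` S" using subspace_0[OF S'(1)] by (auto intro!: image_eqI[of _ _ 0])
      fix x y c assume x: "x \<in> p ` S"
      then show "c *a x \<in> p ` S" using subspace_scale[OF S'(1)] by (auto simp flip: p_scale)
      assume "y \<in> p ` S"
      with x show "x + y \<in> p ` S" using subspace_add[OF S'(1)] by (auto simp flip: p_add)
    qed
    fix x y assume "x \<in> p ` S" "y \<in> p ` S"
    then obtain u v where uv: "x = p u" "y = p v" "u \<in> S" "v \<in> S" by blast
    moreover have "u \<in> C" "v \<in> C" using uv SC by auto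
    ultimately show "p (x \<cdot> y) \<in> p ` S" using S'(2) by simp
  qed
  moreover have "p ` Z \<subseteq> p ` S" using ZS by blast
  ultimately have "is_subalgebra Q hull (p ` Z) \<subseteq> p ` S" by (rule hull_minimal[rotated])
  then have surj: "alg_carrier Q \<subseteq> p ` S" using Z(2) unfolding generates_def by simp
  have "Y \<subseteq> S"
  proof
    fix a assume a: "a \<in> Y"
    then have aC: "a \<in> C" using YC by blast
    then obtain s where s: "p a = p s" "s \<in> S" using surj p_mem_carrier_Q by blast
    have sC: "s \<in> C" using s SC by blast
    have "a = p a \<cdot> p a" using Y(2)[OF a] aC by simp
    also have "\<dots> = s \<cdot> s" using s(1) sC by simp
    finally show "a \<in> S" using S'(2) s by simp
  qed
  then have "C \<subseteq> S" using hull_minimal[of Y S "is_subalgebra A"] S hull by simp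
  then show ?thesis unfolding generates_def using ZC SC unfolding S_def by blast
qed

lemma minimal_generating_axes_Q:
  assumes "minimal_generating_axes F star A Y"
  shows "minimal_generating_axes F star Q (p ` Y)"
proof -
  from assms have Y: "\<And>a. a \<in> Y \<Longrightarrow> axis F star A a" "generates A Y"
    and min: "\<And>Z. Z \<subset> Y \<Longrightarrow> \<not> generates A Z"
    unfolding minimal_generating_axes_def by auto
  have "\<not> generates Q X" if X: "X \<subset> p ` Y" for X
  proof
    assume gen: "generates Q X"
    let ?Z = "{a \<in> Y. p a \<in> X}"
    have "p ` ?Z = X" "?Z \<subset> Y" using X by auto
    with gen min[of ?Z] generates_lift[OF Y(2), of ?Z] Y(1) show False
      unfolding axis_def by auto
  qed
  then show ?thesis
    unfolding minimal_generating_axes_def using Y axis_Q generates_Q by auto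
qed

section \<open>The cocycle and the central extension\<close>

text \<open>
  For the second cocycle condition, the eigencomponents \<open>z \<nu>\<close> lift to eigenvectors of \<open>a\<close> in \<open>A\<close>
  with annihilator parts \<open>\<theta>(a, z \<nu>) / \<nu>\<close>. Their sum differs from the product by an element of
  \<open>Ann(A)\<close> in a sum of eigenspaces with non-zero eigenvalues, that is, by zero.
\<close>

lemma cocycle_Q:
  assumes Y: "\<And>a. a \<in> Y \<Longrightarrow> axis F star A a"
  shows "(\<lambda>x y. q (x \<cdot> y)) \<in> cocycles star Q (alg_scale A) (annihilator A) (p ` Y)"
proof -
  have bil: "bilinear_map_on (alg_scale Q) (alg_scale A) (alg_carrier Q) (\<lambda>x y. q (x \<cdot> y))"
    unfolding bilinear_map_on_def linear_map_on_def
    by (auto simp: mem_carrier_Q q_add q_scale mult_add_right mult_add_left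
        mult_scale_right mult_scale_left)
  have ker: "q (p a \<cdot> y) = 0"
    if "a \<in> Y" "y \<in> alg_carrier Q" "alg_mult Q (p a) y = 0" for a y
  proof -
    have a: "a \<in> C" "semisimple A a" using Y[OF that(1)] unfolding axis_def by auto
    have y: "y \<in> C" using that by (simp add: mem_carrier_Q)
    \<comment> \<open>A product that vanishes in \<open>Q\<close> lies in the annihilator, so
      \<open>L_a\<close> squared kills \<open>y\<close>, and semisimplicity of \<open>a\<close>
      applies.\<close>
    have "a \<cdot> y \<in> annihilator A" using that a y by (simp add: p_eq_0_iff)
    then have "a \<cdot> y = 0" using semisimple_kernel_square[OF a y] a by simp
    then show ?thesis using a y by simp
  qed
  have fusion: "q (x \<cdot> y) = (\<Sum>\<nu>\<in>T. inverse \<nu> *a q (p a \<cdot> z \<nu>))"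
    if aY: "a \<in> Y" and Spec: "\<kappa> \<in> Spec Q (p a)" "\<mu> \<in> Spec Q (p a)" and n0: "0 \<notin> star \<kappa> \<mu>"
      and xy: "x \<in> eigenspace Q (p a) \<kappa>" "y \<in> eigenspace Q (p a) \<mu>"
      and T: "finite T" "T \<subseteq> star \<kappa> \<mu>" "\<And>\<nu>. \<nu> \<in> T \<Longrightarrow> z \<nu> \<in> eigenspace Q (p a) \<nu>"
      and prod: "alg_mult Q x y = (\<Sum>\<nu>\<in>T. z \<nu>)"
    for a \<kappa> \<mu> x y T z
  proof -
    from Y[OF aY] have a: "a \<in> C" "semisimple A a"
      and fus: "\<And>\<kappa> \<mu> x y. \<kappa> \<in> Spec A a \<Longrightarrow> \<mu> \<in> Spec A a \<Longrightarrow> x \<in> eigenspace A a \<kappa> \<Longrightarrow>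
        y \<in> eigenspace A a \<mu> \<Longrightarrow> x \<cdot> y \<in> eigenspaces A a (star \<kappa> \<mu>)"
      unfolding axis_def by auto
    let ?x = "x + inverse \<kappa> *a q (a \<cdot> x)" and ?y = "y + inverse \<mu> *a q (a \<cdot> y)"
    let ?z = "\<lambda>\<nu>. z \<nu> + inverse \<nu> *a q (a \<cdot> z \<nu>)"
    have xyC: "x \<in> C" "y \<in> C" using xy by (auto simp: eigenspace_def mem_carrier_Q)
    have zC: "z \<nu> \<in> C" "q (z \<nu>) = 0" if "\<nu> \<in> T" for \<nu>
      using T(3)[OF that] by (auto simp: eigenspace_def mem_carrier_Q)
    have "?x \<cdot> ?y \<in> eigenspaces A a (star \<kappa> \<mu>)"
      using fus Spec xy Spec_Q_subset[OF a] eigenspace_lift[OF a] by blast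
    then have xyS: "x \<cdot> y \<in> eigenspaces A a (star \<kappa> \<mu>)"
      using xyC by (simp add: mult_add_left mult_add_right mult_scale_left mult_scale_right)
    have zS: "sum ?z T \<in> eigenspaces A a (star \<kappa> \<mu>)"
      unfolding eigenspaces_def
      by (intro span_sum span_base) (use T(2,3) eigenspace_lift[OF a] in blast)
    have "p (sum ?z T) = sum z T"
      unfolding p_sum using p_lift[OF T(3)] by simp
    then have "x \<cdot> y - sum ?z T \<in> annihilator A"
      using prod by (simp flip: p_eq_0_iff add: p_diff)
    moreover have "x \<cdot> y - sum ?z T \<in> eigenspaces A a (star \<kappa> \<mu>)"
      using xyS zS unfolding eigenspaces_def by (rule span_diff)
    ultimately have "x \<cdot> y - sum ?z T = 0"
      using eigenspaces_nonzero_kernel[OF a(1) n0] annihilator_mult(2)[OF _ a(1)] by blast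
    \<comment> \<open>Applying \<open>q\<close> to the equality leaves only the corrections, since
      each \<open>z \<nu>\<close> lies in the kernel of \<open>q\<close>; \<open>a\<close> and
      \<open>p a\<close> have the same products.\<close>
    then have "q (x \<cdot> y) = (\<Sum>\<nu>\<in>T. q (?z \<nu>))" by (simp only: q_sum[symmetric]) simp
    also have "\<dots> = (\<Sum>\<nu>\<in>T. inverse \<nu> *a q (p a \<cdot> z \<nu>))"
      using zC a by (intro sum.cong) (auto simp: q_add q_scale)
    finally show ?thesis .
  qed
  show ?thesis
    unfolding cocycles_def mem_Collect_eq
  proof (intro conjI ballI allI impI subsetI; (elim conjE imageE)?)
    show "q (x \<cdot> y) \<in> annihilator A" for x y by simp
    show "q (x \<cdot> y) = q (y \<cdot> x)" if "x \<in> alg_carrier Q" "y \<in> alg_carrier Q" for x y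
      using that by (simp add: mem_carrier_Q mult_commute)
    show "bilinear_map_on (alg_scale Q) (alg_scale A) (alg_carrier Q) (\<lambda>x y. q (x \<cdot> y))"
      by (rule bil)
  next
    fix b y a assume "y \<in> {y \<in> alg_carrier Q. alg_mult Q b y = 0}" "b = p a" "a \<in> Y"
    then show "y \<in> {y \<in> alg_carrier Q. q (b \<cdot> y) = 0}" using ker by blast
  qed (use fusion in blast)
qed

text \<open>The isomorphism adds the two coordinates, with inverse splitting \<open>x\<close> into
  \<open>p x\<close> and \<open>q x\<close>. It is multiplicative because annihilator summands drop
  out of a product and \<open>x \<cdot> y\<close> is the sum of its images under \<open>p\<close>
  and \<open>q\<close>.\<close>

lemma central_extension_Q: "is_central_extension A Q (\<lambda>x y. q (x \<cdot> y))"
proof -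
  let ?\<phi> = "\<lambda>(x, v). x + v :: 'a"
  let ?E = "central_extension Q (alg_scale A) (annihilator A) (\<lambda>x y. q (x \<cdot> y))"
  interpret pair: module_prod "alg_scale A" "alg_scale A" by unfold_locales
  have "bij_betw ?\<phi> (alg_carrier Q \<times> annihilator A) C"
    by (rule bij_betw_byWitness[of _ "\<lambda>x. (p x, q x)"])
      (auto simp: p_add q_add p_carrier_Q q_id mem_carrier_Q annihilator_carrier p_plus_q
        p_eq_0_iff[THEN iffD2])
  moreover have "linear_map_on (alg_scale ?E) (alg_scale A) (alg_carrier ?E) ?\<phi>"
    unfolding linear_map_on_def central_extension_def
    by (auto simp: pair.scale_def scale_right_distrib)
  moreover have "?\<phi> (alg_mult ?E u w) = ?\<phi> u \<cdot> ?\<phi> w"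
    if "u \<in> alg_carrier ?E" "w \<in> alg_carrier ?E" for u w
    using that unfolding central_extension_def
    by (auto simp: mem_carrier_Q annihilator_carrier mult_add_left mult_add_right p_plus_q)
  ultimately show ?thesis
    unfolding is_central_extension_def alg_iso_def
    by (intro exI[of _ ?\<phi>]) (auto simp: central_extension_def)
qed

end

section \<open>Existence of the projection, and the theorem\<close>

lemma (in commutative_algebra) annihilator_projection_exists:
  obtains q where "annihilator_projection A q"
proof -
  interpret vector_space_pair "alg_scale A" "alg_scale A" by unfold_locales
  have "subspace (annihilator A)"
    unfolding subspace_def annihilator_def
    by (auto simp: mult_add_left mult_scale_left) (use mult_commute in force)
  \<comment> \<open>A linear left inverse of the inclusion of the annihilator, with range in the
    annihilator; it exists in any dimension and is defined on the whole ambient space.\<close>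
  then obtain q where q: "range q \<subseteq> annihilator A"
    "Vector_Spaces.linear (alg_scale A) (alg_scale A) q" "\<forall>v\<in>annihilator A. q v = v"
    using linear_exists_left_inverse_on[of "\<lambda>x. x" "annihilator A"] linear_ident by auto
  have "annihilator_projection A q"
    by unfold_locales (use q linear_add[OF q(2)] linear_scale[OF q(2)] in auto)
  then show thesis by (rule that)
qed

theorem theorem2p15:
  fixes F :: "'f::field set" and star :: "'f \<Rightarrow> 'f \<Rightarrow> 'f set"
    and B :: "('f, 'b::ab_group_add) alg" and Y :: "'b set"
  assumes "fusion_law F star"
    and "axial_algebra F star B Y"
    and "annihilator B \<noteq> {0}"
  shows "\<exists>(A :: ('f, 'b) alg) X \<theta>.
           axial_algebra F star A X \<and>
           \<theta> \<in> cocycles star A (alg_scale B) (annihilator B) X \<and>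
           is_central_extension B A \<theta> \<and>
           (minimal_generating_axes F star B Y \<longrightarrow> minimal_generating_axes F star A X)"
proof -
  interpret commutative_algebra B
    by unfold_locales (use assms(2) in \<open>simp add: axial_algebra_def\<close>)
  obtain q where "annihilator_projection B q" by (rule annihilator_projection_exists)
  then interpret annihilator_projection B q .
  have "axial_algebra F star Q (p ` Y)"
    using assms(2) axis_Q generates_Q comm_algebra_Q unfolding axial_algebra_def by auto
  moreover have "(\<lambda>x y. q (alg_mult B x y)) \<in> cocycles star Q (alg_scale B) (annihilator B) (p ` Y)"
    using assms(2) by (intro cocycle_Q) (auto simp: axial_algebra_def)
  ultimately show ?thesis
    using central_extension_Q minimal_generating_axes_Q by blast
qed

end
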